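(* Let $G$ be a connected graph of order $n \ge 3$. If $\Phi_c(G) = 2$, then $h(G) \ge 3$.
   Context: Graphs are finite, simple and undirected. A set $S \subseteq V(G)$ is $\Delta$-convex if there is no vertex $w \in V(G)\setminus S$ that forms a triangle (three pairwise adjacent vertices) with two vertices of $S$. A $\Delta$-convex $p$-cover of $G$ is a family of $p$ $\Delta$-convex sets whose union is $V(G)$ and such that every member has an element belonging to no other member. The $\Delta$-cover number $\Phi_c(G)$ is the minimum $p \ge 2$ such that $G$ admits a $\Delta$-convex $p$-cover. The $\Delta$-convex hull of $S \subseteq V(G)$ is the minimum $\Delta$-convex set containing $S$. The $\Delta$-hull number $h(G)$ is the minimum cardinality of a set of vertices whose $\Delta$-convex hull is $V(G)$. *)

theory Defs
  imports "Graph_Theory.Graph_Theory"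
begin

text \<open>
  A finite simple undirected graph is a value \<open>G\<close> satisfying the locale predicate \<open>graph\<close>:
  a finite, loop-free symmetric digraph without parallel arcs.
  Adjacency of \<open>u\<close> and \<open>v\<close> is \<open>u \<rightarrow>\<^bsub>G\<^esub> v\<close>.
\<close>

text \<open>Since a graph has no loops, pairwise adjacency makes the three vertices distinct.\<close>

definition forms_triangle :: "('a, 'b) pre_digraph \<Rightarrow> 'a \<Rightarrow> 'a \<Rightarrow> 'a \<Rightarrow> bool" where
  "forms_triangle G u v w \<longleftrightarrow> u \<rightarrow>\<^bsub>G\<^esub> v \<and> v \<rightarrow>\<^bsub>G\<^esub> w \<and> u \<rightarrow>\<^bsub>G\<^esub> w"

definition delta_convex :: "('a, 'b) pre_digraph \<Rightarrow> 'a set \<Rightarrow> bool" where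
  "delta_convex G S \<longleftrightarrow> S \<subseteq> verts G \<and>
     \<not> (\<exists>w \<in> verts G - S. \<exists>u \<in> S. \<exists>v \<in> S. forms_triangle G u v w)"

text \<open>
  Covers are sets of sets: the private-element condition already excludes repeated members,
  and for \<open>p > 0\<close> the equation \<open>card F = p\<close> forces \<open>F\<close> to be finite.
\<close>

definition delta_convex_cover :: "('a, 'b) pre_digraph \<Rightarrow> nat \<Rightarrow> 'a set set \<Rightarrow> bool" where
  "delta_convex_cover G p F \<longleftrightarrow>
     card F = p \<and> (\<forall>S \<in> F. delta_convex G S) \<and> \<Union>F = verts G \<and>
     (\<forall>S \<in> F. \<exists>x \<in> S. \<forall>T \<in> F. T \<noteq> S \<longrightarrow> x \<notin> T)"

definition delta_cover_number :: "('a, 'b) pre_digraph \<Rightarrow> nat" where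
  "delta_cover_number G = (LEAST p. p \<ge> 2 \<and> (\<exists>F. delta_convex_cover G p F))"

definition delta_hull :: "('a, 'b) pre_digraph \<Rightarrow> 'a set \<Rightarrow> 'a set" where
  "delta_hull G S = delta_convex G hull S"

definition delta_hull_number :: "('a, 'b) pre_digraph \<Rightarrow> nat" where
  "delta_hull_number G =
     (LEAST k. \<exists>S \<subseteq> verts G. card S = k \<and> delta_hull G S = verts G)"

text \<open>
  The hull is the least \<open>\<Delta>\<close>-convex superset, and both minima are attained
  (for the cover number: as soon as there are two vertices).
\<close>

lemma delta_convex_verts: "delta_convex G (verts G)"
  by (simp add: delta_convex_def)

lemma delta_hull_least:
  assumes "S \<subseteq> verts G"
  shows "delta_convex G (delta_hull G S)" and "S \<subseteq> delta_hull G S"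
    and "\<And>T. delta_convex G T \<Longrightarrow> S \<subseteq> T \<Longrightarrow> delta_hull G S \<subseteq> T"
proof -
  have sub: "delta_hull G S \<subseteq> verts G"
    unfolding delta_hull_def by (rule hull_minimal[where S = "delta_convex G", OF assms delta_convex_verts])
  have "w \<in> delta_hull G S"
    if "w \<in> verts G" "u \<in> delta_hull G S" "v \<in> delta_hull G S" "forms_triangle G u v w" for u v w
    unfolding delta_hull_def hull_def
  proof (rule InterI, elim CollectE conjE)
    fix T assume T: "delta_convex G T" "S \<subseteq> T"
    have "u \<in> T" "v \<in> T"
      using that(2,3) T by (simp_all add: delta_hull_def hull_def)
    with T(1) that(1,4) show "w \<in> T"
      unfolding delta_convex_def by blast
  qed
  with sub show "delta_convex G (delta_hull G S)"
    unfolding delta_convex_def by blast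
  show "S \<subseteq> delta_hull G S"
    unfolding delta_hull_def by (rule hull_subset)
  show "delta_hull G S \<subseteq> T" if "delta_convex G T" "S \<subseteq> T" for T
    unfolding delta_hull_def using that(2,1) by (rule hull_minimal[where S = "delta_convex G"])
qed

lemma delta_hull_number_attained:
  "\<exists>S \<subseteq> verts G. card S = delta_hull_number G \<and> delta_hull G S = verts G"
proof -
  have "delta_hull G (verts G) = verts G"
    using delta_hull_least(2,3)[of "verts G" G] delta_convex_verts[of G] by blast
  then have "\<exists>k. \<exists>S \<subseteq> verts G. card S = k \<and> delta_hull G S = verts G"
    by blast
  then show ?thesis
    unfolding delta_hull_number_def by (rule LeastI_ex)
qed

lemma delta_cover_number_attained:
  assumes "graph G" and "card (verts G) \<ge> 2"
  shows "delta_cover_number G \<ge> 2 \<and> (\<exists>F. delta_convex_cover G (delta_cover_number G) F)"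
proof -
  interpret graph G by (rule assms(1))
  let ?F = "(\<lambda>v. {v}) ` verts G"
  have "card ?F = card (verts G)"
    by (intro card_image) (simp add: inj_on_def)
  moreover have "delta_convex G {v}" if "v \<in> verts G" for v
    using that adj_not_same[of v] unfolding delta_convex_def forms_triangle_def by blast
  ultimately have "delta_convex_cover G (card (verts G)) ?F"
    by (simp add: delta_convex_cover_def)
  then have "\<exists>p. p \<ge> 2 \<and> (\<exists>F. delta_convex_cover G p F)"
    using assms(2) by blast
  then show ?thesis
    unfolding delta_cover_number_def by (rule LeastI_ex)
qed

end

theory Submission
  imports Defs
begin

text \<open>
  A generating set with at most two vertices is not \<open>\<Delta>\<close>-convex, so it is a pair \<open>{u, v}\<close> lying in
  a triangle \<open>uvw\<close>. No member of a 2-cover contains both \<open>u\<close> and \<open>v\<close>, since it would then be all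
  of \<open>V(G)\<close>; so the two members separate \<open>u\<close> from \<open>v\<close>. The member containing \<open>w\<close> then contains
  exactly two vertices of the triangle, which contradicts its convexity.
\<close>

lemma delta_convexD:
  assumes "delta_convex G S" "u \<in> S" "v \<in> S" "w \<in> verts G" "forms_triangle G u v w"
  shows "w \<in> S"
  using assms unfolding delta_convex_def by blast

text \<open>The private element of each member lies outside the other, so neither member is all of
  \<open>verts G\<close>.\<close>

lemma delta_convex_coverE_2:
  assumes "delta_convex_cover G 2 F"
  obtains A B where "delta_convex G A" "delta_convex G B" "A \<union> B = verts G"
    "\<not> verts G \<subseteq> A" "\<not> verts G \<subseteq> B"
proof -
  from assms have "card F = 2" and conv: "\<forall>S \<in> F. delta_convex G S" and un: "\<Union>F = verts G"
    and priv: "\<forall>S \<in> F. \<exists>x \<in> S. \<forall>T \<in> F. T \<noteq> S \<longrightarrow> x \<notin> T"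
    unfolding delta_convex_cover_def by auto
  then obtain A B where F: "F = {A, B}" and "A \<noteq> B"
    by (auto simp: card_2_iff)
  have "\<not> verts G \<subseteq> A" "\<not> verts G \<subseteq> B"
    using priv un \<open>A \<noteq> B\<close> unfolding F by auto
  then show thesis
    using that[of A B] conv un unfolding F by auto
qed

theorem lemma10:
  fixes G :: "('a, 'b) pre_digraph"
  assumes "graph G"
    and "connected G"
    and "card (verts G) \<ge> 3"
    and "delta_cover_number G = 2"
  shows "delta_hull_number G \<ge> 3"
proof (rule ccontr)
  assume "\<not> delta_hull_number G \<ge> 3"
  then obtain S where S: "S \<subseteq> verts G" "card S \<le> 2" "delta_hull G S = verts G"
    using delta_hull_number_attained[of G] by force
  interpret graph G by (rule assms(1))
  have "finite S"
    using S(1) finite_verts by (rule finite_subset)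
  have hull: "verts G \<subseteq> T" if "delta_convex G T" "S \<subseteq> T" for T
    using delta_hull_least(3)[OF S(1) that] S(3) by simp
  \<comment> \<open>A convex \<open>S\<close> would be its own hull, forcing
    \<open>card (verts G) \<le> 2\<close>.\<close>
  have "\<not> delta_convex G S"
    using hull[of S] S(2) assms(3) card_mono[OF \<open>finite S\<close>, of "verts G"] by auto
  then obtain u v w where uv: "u \<in> S" "v \<in> S" and w: "w \<in> verts G"
    and adj: "u \<rightarrow>\<^bsub>G\<^esub> v" "v \<rightarrow>\<^bsub>G\<^esub> w" "u \<rightarrow>\<^bsub>G\<^esub> w"
    using S(1) unfolding delta_convex_def forms_triangle_def by blast
  have "u \<noteq> v"
    using adj(1) adj_not_same by blast
  have "S = {u, v}"
    using card_seteq[of S "{u, v}"] \<open>finite S\<close> uv S(2) \<open>u \<noteq> v\<close> by simp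
  \<comment> \<open>\<open>delta_convexD\<close> yields the last vertex of a triangle, so the
    triangle is reordered to end in \<open>v\<close> and in \<open>u\<close>.\<close>
  have tri: "forms_triangle G u w v" "forms_triangle G v w u"
    using adj unfolding forms_triangle_def
    using sym_arcs by (auto simp: symmetric_def dest: symD)
  obtain F where "delta_convex_cover G 2 F"
    using delta_cover_number_attained[OF assms(1)] assms(3,4) by auto
  then obtain A B where AB: "delta_convex G A" "delta_convex G B" "A \<union> B = verts G"
    "\<not> verts G \<subseteq> A" "\<not> verts G \<subseteq> B"
    by (rule delta_convex_coverE_2)
  have separated: "\<not> (u \<in> T \<and> v \<in> T)" if "T \<in> {A, B}" for T
    using hull[of T] that AB \<open>S = {u, v}\<close> by auto
  have avoids: "w \<notin> T" if T: "T \<in> {A, B}" for T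
  proof
    assume "w \<in> T"
    have "delta_convex G T"
      using T AB(1,2) by blast
    \<comment> \<open>Together with \<open>w\<close>, either of \<open>u\<close> and
      \<open>v\<close> brings in the other by convexity.\<close>
    then have "u \<in> T \<longleftrightarrow> v \<in> T"
      using delta_convexD[of G T _ w] tri \<open>w \<in> T\<close> uv S(1) by blast
    \<comment> \<open>The other member misses \<open>u\<close> or \<open>v\<close>, and the cover
      leaves that vertex to \<open>T\<close>.\<close>
    moreover have "u \<in> T \<or> v \<in> T"
      using separated AB(3) uv S(1) T by blast
    ultimately show False
      using separated[OF T] by blast
  qed
  show False
    using avoids AB(3) w by blast
qed

end
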